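(* Let $\lambda,P_t,C,D>0$ and $\alpha>1$ be real numbers, and put $z=P_tC$, $x_{2,0}=1$, $x_{2,k}=kD$ for integers $k\ge1$, and $\beta_k=x_{2,k}^{\alpha}$ for $k\ge0$. Let $(\Phi_k)_{k\ge0}$ be independent homogeneous Poisson point processes, each of intensity $\lambda$ on $\{x\in\mathbb{R}:|x|\ge1\}$, whose points $x_i$ carry i.i.d. marks $h_i\sim\exp(1)$ (exponential with mean $1$), independent of all the point processes. Let $$I_{\Phi}=\sum_{k=0}^{\infty}\ \sum_{x_i\in\Phi_k}P_t\,h_i\,l(x_i,x_{2,k}),\qquad l(x_1,x_2)=C\,|x_1|^{-2}x_2^{-\alpha}.$$ Then the first two moments of $I_\Phi$ are $$\mathbb{E}\{I_\Phi\}=2\lambda\sum_{k=0}^\infty\frac{z}{\beta_k}=2\lambda z\left(1+\frac{\zeta(\alpha)}{D^{\alpha}}\right),$$ $$\mathbb{E}\{I_\Phi^2\}=\frac{4\lambda}{3}\sum_{k=0}^\infty\frac{z^2}{\beta_k^2}+\mathbb{E}\{I_\Phi\}^2=\frac{4\lambda z^2}{3}\left(1+\frac{\zeta(2\alpha)}{D^{2\alpha}}\right)+\mathbb{E}\{I_\Phi\}^2,$$ where $\zeta$ denotes the Riemann zeta function.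
   Context: Interpretation: $\Phi_k$ is the set of positions of transmitting cars along the $k$-th vertical street of a Manhattan street grid, $D$ is the distance between neighbouring streets, $P_t$ is the transmit power, $h_i$ is the Rayleigh fading power gain, $l$ is the path loss (in its non-singular version, where only transmitters at distance $|x_1|\ge1$ along the street are taken into account), and $I_\Phi$ is the total interference from all vertical streets. *)

theory Defs
  imports "HOL-Probability.Probability"
begin

definition point_count :: "'b set \<Rightarrow> 'b set \<Rightarrow> ennreal" where
  "point_count B S = emeasure (count_space UNIV) (S \<inter> B)"

(* Point configurations on the measurable space N, i.e. subsets of its carrier type, with the
   sigma-algebra generated by the counting maps; this is the state space of a point process. *)
definition config_space :: "'b measure \<Rightarrow> 'b set measure" where
  "config_space N = sigma UNIV {point_count B -` A | B A. B \<in> sets N \<and> A \<in> sets borel}"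

(* Poisson point process with intensity measure N. Counts are extended-real valued, so the
   probabilities below (which sum to 1 over n) force a finite number of points almost surely
   in every set of finite intensity. *)
definition poisson_point_process :: "'a measure \<Rightarrow> 'b measure \<Rightarrow> ('a \<Rightarrow> 'b set) \<Rightarrow> bool" where
  "poisson_point_process M N \<Phi> \<longleftrightarrow>
     prob_space M \<and>
     \<Phi> \<in> measurable M (config_space N) \<and>
     (\<forall>B\<in>sets N. emeasure N B < \<infinity> \<longrightarrow>
        (\<forall>n. measure M {\<omega> \<in> space M. point_count B (\<Phi> \<omega>) = of_nat n} =
               measure N B ^ n / fact n * exp (- measure N B))) \<and>
     (\<forall>(B :: nat \<Rightarrow> 'b set) J. finite J \<longrightarrow> disjoint_family_on B J \<longrightarrow>
        (\<forall>j\<in>J. B j \<in> sets N \<and> emeasure N (B j) < \<infinity>) \<longrightarrow>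
        prob_space.indep_vars M (\<lambda>_. borel) (\<lambda>j \<omega>. point_count (B j) (\<Phi> \<omega>)) J)"

(* Intensity measure of the homogeneous process of intensity lam on {x. |x| >= 1}. *)
definition street_intensity :: "real \<Rightarrow> real measure" where
  "street_intensity lam =
     density lborel (\<lambda>x. ennreal lam * indicator {x. 1 \<le> \<bar>x\<bar>} x)"

(* A measurable enumeration, almost surely without repetition, of the points of a process that
   almost surely has infinitely many points. *)
definition enumerates_points ::
  "'a measure \<Rightarrow> ('a \<Rightarrow> real set) \<Rightarrow> (nat \<Rightarrow> 'a \<Rightarrow> real) \<Rightarrow> bool" where
  "enumerates_points M \<Phi> X \<longleftrightarrow>
     (\<forall>i. X i \<in> borel_measurable M) \<and>
     (AE \<omega> in M. bij_betw (\<lambda>i. X i \<omega>) UNIV (\<Phi> \<omega>))"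

(* Marks h k i attached to the points X k i: i.i.d. exp(1), and independent of the family of all
   points. Independence is required of the enumerated points (which determine the processes almost
   surely) and not just of the unordered configurations: otherwise the enumeration itself
   could depend on the marks. *)
definition iid_exp_marks ::
  "'a measure \<Rightarrow> (nat \<Rightarrow> nat \<Rightarrow> 'a \<Rightarrow> real) \<Rightarrow> (nat \<Rightarrow> nat \<Rightarrow> 'a \<Rightarrow> real) \<Rightarrow> bool" where
  "iid_exp_marks M X h \<longleftrightarrow>
     (\<forall>k i. distributed M lborel (h k i) (exponential_density 1)) \<and>
     prob_space.indep_vars M (\<lambda>_. borel) (\<lambda>(k, i). h k i) UNIV \<and>
     prob_space.indep_var M
       (Pi\<^sub>M UNIV (\<lambda>_. borel)) (\<lambda>\<omega> (k, i). h k i \<omega>)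
       (Pi\<^sub>M UNIV (\<lambda>_. borel)) (\<lambda>\<omega> (k, i). X k i \<omega>)"

definition street_dist :: "real \<Rightarrow> nat \<Rightarrow> real" where
  "street_dist D k = (if k = 0 then 1 else real k * D)"

definition path_loss :: "real \<Rightarrow> real \<Rightarrow> real \<Rightarrow> real \<Rightarrow> real" where
  "path_loss C \<alpha> x1 x2 = C * \<bar>x1\<bar> powr (-2) * x2 powr (- \<alpha>)"

(* The summands are almost surely nonnegative, so the interference is a sum in [0, \<infinity>]. *)
definition interference ::
  "real \<Rightarrow> real \<Rightarrow> real \<Rightarrow> real \<Rightarrow> (nat \<Rightarrow> nat \<Rightarrow> 'a \<Rightarrow> real) \<Rightarrow>
     (nat \<Rightarrow> nat \<Rightarrow> 'a \<Rightarrow> real) \<Rightarrow> 'a \<Rightarrow> ennreal" where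
  "interference Pt C D \<alpha> X h \<omega> =
     (\<Sum>k. \<Sum>i. ennreal (Pt * h k i \<omega> * path_loss C \<alpha> (X k i \<omega>) (street_dist D k)))"

(* The Riemann zeta function on its half-line of absolute convergence s > 1. *)
definition riemann_zeta :: "real \<Rightarrow> real" where
  "riemann_zeta s = (\<Sum>n. 1 / real (Suc n) powr s)"

end

theory Submission
  imports Defs
begin

text \<open>
  Write the interference as a single series of terms \<open>H\<^sub>p Y\<^sub>p\<close>, with marks \<open>H\<^sub>p\<close> independent of the
  location weights \<open>Y\<^sub>p\<close>. As \<open>E(H\<^sub>p H\<^sub>q) = 1\<close> for \<open>p \<noteq> q\<close> and \<open>E(H\<^sub>p\<^sup>2) = 2\<close>, the marks can be
  integrated out: the first moment becomes \<open>E(\<Sum>Y\<^sub>p)\<close> and the second \<open>E((\<Sum>Y\<^sub>p)\<^sup>2) + E(\<Sum>Y\<^sub>p\<^sup>2)\<close>.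
  These are moments of sums over Poisson points, which Campbell's formulas of first and second
  order evaluate; the two variance contributions to the second moment are equal, which turns
  \<open>2\<lambda>/3 = \<lambda>\<integral>x\<^sup>-\<^sup>4\<close> into \<open>4\<lambda>/3\<close>. All terms are nonnegative, so interchanging sums and integrals is
  unproblematic in \<open>[0, \<infinity>]\<close>. Both Campbell formulas come from one weighted version: it is
  applied with the weight \<open>1\<close>, then with the number of points in a set, and finally with a sum
  over the points.
\<close>

section \<open>Sums over the points of a configuration\<close>

text \<open>Integration against counting measure is the unordered sum over the points, so no
  enumeration has to be chosen and monotone convergence applies directly.\<close>

definition point_sum :: "('b \<Rightarrow> ennreal) \<Rightarrow> 'b set \<Rightarrow> ennreal" where
  "point_sum f S = (\<integral>\<^sup>+x. f x \<partial>count_space S)"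

lemma point_sum_indicator: "point_sum (indicator B) S = point_count B S"
  by (simp add: point_sum_def point_count_def nn_integral_count_space_indicator
      nn_integral_indicator[symmetric] indicator_inter_arith mult.commute
      del: nn_integral_indicator)

lemma point_sum_add: "point_sum (\<lambda>x. f x + g x) S = point_sum f S + point_sum g S"
  by (simp add: point_sum_def nn_integral_add)

lemma point_sum_cmult: "point_sum (\<lambda>x. c * f x) S = c * point_sum f S"
  by (simp add: point_sum_def nn_integral_cmult)

lemma point_sum_SUP:
  "incseq U \<Longrightarrow> point_sum (SUP i. U i) S = (SUP i. point_sum (U i) S)"
  by (simp add: point_sum_def nn_integral_monotone_convergence_SUP image_comp)

lemma incseq_point_sum: "incseq U \<Longrightarrow> incseq (\<lambda>i. point_sum (U i) S)"
  unfolding incseq_def point_sum_def le_fun_def by (auto intro!: nn_integral_mono)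

text \<open>The bridge from unordered sums to the enumerated series of the interference: a sum of
  nonnegative terms does not depend on their order.\<close>

lemma point_sum_bij:
  assumes "bij_betw X (UNIV :: nat set) S"
  shows "point_sum f S = (\<Sum>i. f (X i))"
  unfolding point_sum_def using nn_integral_bij_count_space[OF assms, of f]
  by (simp add: nn_integral_count_space_nat)

text \<open>Identifies the configuration space of the street intensity with that of
  \<open>borel\<close>, over which the independence of the streets is stated.\<close>

lemma sets_config_space_cong: "sets N = sets N' \<Longrightarrow> config_space N = config_space N'"
  by (simp add: config_space_def)

lemma space_config_space [simp]: "space (config_space N) = UNIV"
  unfolding config_space_def by (rule space_measure_of) auto

lemma measurable_point_count [measurable]:
  assumes "B \<in> sets N"
  shows "point_count B \<in> borel_measurable (config_space N)"
proof (rule measurableI)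
  fix A :: "ennreal set" assume "A \<in> sets borel"
  with assms show "point_count B -` A \<inter> space (config_space N) \<in> sets (config_space N)"
    unfolding space_config_space unfolding config_space_def
    by (subst sets_measure_of) (auto intro!: sigma_sets.Basic)
qed simp

text \<open>Counts are the generators, and linear combinations and increasing limits carry
  measurability on to sums. With \<open>space N = UNIV\<close>, functions that agree on
  \<open>space N\<close> are equal and have the same sums over every configuration.\<close>

lemma measurable_point_sum [measurable]:
  assumes "f \<in> borel_measurable N" and "space N = UNIV"
  shows "point_sum f \<in> borel_measurable (config_space N)"
  using assms(1)
proof (induction rule: borel_measurable_induct)
  case (cong f g)
  then have "f = g" using assms(2) by auto
  with cong show ?case by simp
next
  case (set A)
  then show ?case by (simp add: point_sum_indicator[abs_def] measurable_point_count)
next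
  case (mult u c)
  then show ?case by (simp add: point_sum_cmult[abs_def])
next
  case (add u v)
  then show ?case by (simp add: point_sum_add[abs_def])
next
  case (seq U)
  then have eq: "point_sum (SUP i. U i) = (\<lambda>S. SUP i. point_sum (U i) S)"
    by (intro ext point_sum_SUP)
  show ?case unfolding eq using seq.IH by simp
qed

text \<open>Both sides are additive, homogeneous and continuous along increasing sequences in
  \<open>f\<close>, so agreement on sets of finite intensity extends to all nonnegative
  \<open>f\<close>. The weight \<open>w\<close> may depend on the configuration;
  \<open>\<nu>\<close> is the resulting weighted mean of the counts.\<close>

lemma weighted_campbell:
  fixes N :: "'b measure"
  assumes N: "sigma_finite_measure N" "space N = UNIV"
    and \<Phi> [measurable]: "\<Phi> \<in> measurable M (config_space N)"
    and w [measurable]: "w \<in> borel_measurable M"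
    and \<nu>: "sets \<nu> = sets N"
    and finite: "\<And>A. A \<in> sets N \<Longrightarrow> emeasure N A < \<infinity> \<Longrightarrow>
      (\<integral>\<^sup>+\<omega>. point_count A (\<Phi> \<omega>) * w \<omega> \<partial>M) = emeasure \<nu> A"
    and f: "f \<in> borel_measurable N"
  shows "(\<integral>\<^sup>+\<omega>. point_sum f (\<Phi> \<omega>) * w \<omega> \<partial>M) = (\<integral>\<^sup>+x. f x \<partial>\<nu>)"
proof -
  note [measurable] = measurable_point_sum[OF _ N(2)]
  have [measurable_cong]: "sets \<nu> = sets N" by (fact \<nu>)
  \<comment> \<open>Monotone convergence on both sides. It serves the limit case of the induction
    and also the passage to sets of infinite intensity.\<close>
  have SUP: "(\<integral>\<^sup>+\<omega>. point_sum (SUP i. U i) (\<Phi> \<omega>) * w \<omega> \<partial>M) = (\<integral>\<^sup>+x. (SUP i. U i) x \<partial>\<nu>)"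
    if [measurable]: "\<And>i. U i \<in> borel_measurable N" and "incseq U"
      and eq: "\<And>i. (\<integral>\<^sup>+\<omega>. point_sum (U i) (\<Phi> \<omega>) * w \<omega> \<partial>M) = (\<integral>\<^sup>+x. U i x \<partial>\<nu>)"
    for U :: "nat \<Rightarrow> 'b \<Rightarrow> ennreal"
  proof -
    have "(\<integral>\<^sup>+\<omega>. point_sum (SUP i. U i) (\<Phi> \<omega>) * w \<omega> \<partial>M)
        = (\<integral>\<^sup>+\<omega>. (SUP i. point_sum (U i) (\<Phi> \<omega>) * w \<omega>) \<partial>M)"
      by (simp add: point_sum_SUP[OF \<open>incseq U\<close>] SUP_mult_right_ennreal)
    also have "\<dots> = (SUP i. \<integral>\<^sup>+\<omega>. point_sum (U i) (\<Phi> \<omega>) * w \<omega> \<partial>M)"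
      using incseq_point_sum[OF \<open>incseq U\<close>]
      by (intro nn_integral_monotone_convergence_SUP)
         (auto simp: incseq_def le_fun_def intro!: mult_right_mono)
    also have "\<dots> = (SUP i. \<integral>\<^sup>+x. U i x \<partial>\<nu>)"
      by (simp add: eq)
    also have "\<dots> = (\<integral>\<^sup>+x. (SUP i. U i x) \<partial>\<nu>)"
      using \<open>incseq U\<close> by (intro nn_integral_monotone_convergence_SUP[symmetric]) auto
    finally show ?thesis by (simp add: image_comp)
  qed
  from f show ?thesis
  proof (induction rule: borel_measurable_induct)
    case (cong f g)
    then have "f = g" using N(2) by auto
    with cong show ?case by simp
  next
    case [measurable]: (set A)
    obtain F where F: "range F \<subseteq> sets N" "(\<Union>i. F i) = space N"
        "\<And>i. emeasure N (F i) \<noteq> \<infinity>" "incseq F"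
      using sigma_finite_measure.sigma_finite_incseq[OF N(1)] by blast
    have [measurable]: "F i \<in> sets N" for i using F(1) by auto
    have le: "i \<le> j \<Longrightarrow> F i \<subseteq> F j" for i j using F(4) by (auto simp: incseq_def)
    \<comment> \<open>The hypothesis speaks only of sets of finite intensity, so a general
      \<open>A\<close> is exhausted by its intersections with the sets \<open>F i\<close>.\<close>
    define U where "U i = (indicator (A \<inter> F i) :: 'b \<Rightarrow> ennreal)" for i
    have "incseq U"
      unfolding incseq_def le_fun_def U_def using le by (auto simp: indicator_def)
    have "(SUP i. U i) x = indicator A x" for x
    proof -
      obtain i where "x \<in> F i" using F(2) N(2) by auto
      then have "indicator A x \<le> (SUP i. U i x)"
        by (intro SUP_upper2[of i]) (auto simp: U_def indicator_def)
      moreover have "(SUP i. U i x) \<le> indicator A x"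
        by (intro SUP_least) (auto simp: U_def indicator_def)
      ultimately show ?thesis by (simp add: image_comp)
    qed
    then have A: "indicator A = (SUP i. U i)" by auto
    have fin: "emeasure N (A \<inter> F i) < \<infinity>" for i
      using F(3)[of i] emeasure_mono[of "A \<inter> F i" "F i" N] by (auto simp: less_top top_unique)
    show ?case
      unfolding A
    proof (rule SUP)
      show "U i \<in> borel_measurable N" for i by (simp add: U_def)
      show "(\<integral>\<^sup>+\<omega>. point_sum (U i) (\<Phi> \<omega>) * w \<omega> \<partial>M) = (\<integral>\<^sup>+x. U i x \<partial>\<nu>)" for i
        unfolding U_def point_sum_indicator using finite[OF _ fin] by (simp add: \<nu>)
    qed fact
  next
    case (mult u c)
    note [measurable] = mult(2)
    show ?case
      using mult by (simp add: point_sum_cmult mult.assoc nn_integral_cmult)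
  next
    case (add u v)
    note [measurable] = add(1,4)
    show ?case
      using add by (simp add: point_sum_add distrib_right nn_integral_add)
  next
    case (seq U)
    then show ?case by (intro SUP) auto
  qed
qed

section \<open>Moments of Poisson point processes\<close>

text \<open>The Poisson weights satisfy n p(n) = m p(n-1). Each factor n thus lowers the index by
  one, which reduces the first moment to the total mass and the second to the first moment plus the
  total mass.\<close>

lemma poisson_moment_sums:
  fixes m :: real
  shows "(\<lambda>n. real n * (m ^ n / fact n * exp (- m))) sums m"
    and "(\<lambda>n. (real n)\<^sup>2 * (m ^ n / fact n * exp (- m))) sums (m + m\<^sup>2)"
proof -
  define p where "p n = m ^ n / fact n * exp (- m)" for n :: nat
  have p: "p sums 1"
    using sums_mult2[OF exp_converges[of m], of "exp (- m)"]
    by (simp add: p_def[abs_def] exp_minus field_simps)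
  have p_Suc: "real (Suc n) * p (Suc n) = m * p n" for n
    by (simp add: p_def del: of_nat_Suc)
  have "(\<lambda>n. real (Suc n) * p (Suc n)) sums m"
    using sums_mult[OF p, of m] unfolding p_Suc by simp
  \<comment> \<open>Undoing the shift adds only the term at n = 0, which vanishes.\<close>
  then have 1: "(\<lambda>n. real n * p n) sums m"
    by (subst (asm) sums_Suc_iff) simp
  have "(real (Suc n))\<^sup>2 * p (Suc n) = m * (real n * p n) + m * p n" for n
  proof -
    have "(real (Suc n))\<^sup>2 * p (Suc n) = real (Suc n) * (real (Suc n) * p (Suc n))"
      by (simp only: power2_eq_square mult.assoc)
    then show ?thesis unfolding p_Suc by (simp add: algebra_simps)
  qed
  then have "(\<lambda>n. (real (Suc n))\<^sup>2 * p (Suc n)) sums (m * m + m)"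
    using sums_add[OF sums_mult[OF 1, of m] sums_mult[OF p, of m]] by simp
  then have "(\<lambda>n. (real n)\<^sup>2 * p n) sums (m + m\<^sup>2)"
    by (subst (asm) sums_Suc_iff) (simp add: power2_eq_square add.commute)
  with 1 show "(\<lambda>n. real n * (m ^ n / fact n * exp (- m))) sums m"
    and "(\<lambda>n. (real n)\<^sup>2 * (m ^ n / fact n * exp (- m))) sums (m + m\<^sup>2)"
    unfolding p_def by simp_all
qed

text \<open>The prescribed probabilities add up to 1, so \<open>K\<close> is almost surely a finite
  natural number and its moments are series over the level sets of \<open>K\<close>.\<close>

lemma (in prob_space) poisson_moments:
  fixes K :: "'a \<Rightarrow> ennreal"
  assumes K [measurable]: "K \<in> borel_measurable M"
    and m: "0 \<le> m"
    and prob: "\<And>n. prob {\<omega> \<in> space M. K \<omega> = of_nat n} = m ^ n / fact n * exp (- m)"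
  shows "(\<integral>\<^sup>+\<omega>. K \<omega> \<partial>M) = ennreal m"
    and "(\<integral>\<^sup>+\<omega>. (K \<omega>)\<^sup>2 \<partial>M) = ennreal (m + m\<^sup>2)"
proof -
  let ?A = "\<lambda>n. {\<omega> \<in> space M. K \<omega> = of_nat n}"
  have disj: "disjoint_family ?A"
    by (auto simp: disjoint_family_on_def)
  have "(\<lambda>n. prob (?A n)) sums prob (\<Union>n. ?A n)"
    by (intro finite_measure_UNION disj) auto
  moreover have "(\<lambda>n. prob (?A n)) sums 1"
    unfolding prob using sums_mult2[OF exp_converges[of m], of "exp (- m)"]
    by (simp add: exp_minus field_simps)
  ultimately have "prob (\<Union>n. ?A n) = 1"
    by (rule sums_unique2)
  then have "AE \<omega> in M. \<omega> \<in> (\<Union>n. ?A n)"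
    by (subst (asm) prob_eq_1) auto
  then have nat: "AE \<omega> in M. \<exists>n. K \<omega> = of_nat n"
    by (rule AE_mp) auto
  have moment: "(\<integral>\<^sup>+\<omega>. K \<omega> ^ j \<partial>M) = ennreal s"
    if s: "(\<lambda>n. real n ^ j * (m ^ n / fact n * exp (- m))) sums s" for j s
  proof -
    have "(\<integral>\<^sup>+\<omega>. K \<omega> ^ j \<partial>M) = (\<integral>\<^sup>+\<omega>. (\<Sum>n. of_nat n ^ j * indicator (?A n) \<omega>) \<partial>M)"
    proof (rule nn_integral_cong_AE)
      show "AE \<omega> in M. K \<omega> ^ j = (\<Sum>n. of_nat n ^ j * indicator (?A n) \<omega>)"
        using nat AE_space
      proof eventually_elim
        case (elim \<omega>)
        then obtain k where k: "K \<omega> = of_nat k" by auto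
        have "(\<Sum>n. of_nat n ^ j * indicator (?A n) \<omega>)
            = (\<Sum>n\<in>{k}. of_nat n ^ j * indicator (?A n) \<omega> :: ennreal)"
          by (rule suminf_finite) (auto simp: k)
        then show ?case using elim by (simp add: k)
      qed
    qed
    also have "\<dots> = (\<Sum>n. of_nat n ^ j * emeasure M (?A n))"
      by (subst nn_integral_suminf) (auto simp: nn_integral_cmult_indicator)
    also have "\<dots> = (\<Sum>n. ennreal (real n ^ j * (m ^ n / fact n * exp (- m))))"
      unfolding emeasure_eq_measure prob
      by (simp only: ennreal_of_nat_eq_real_of_nat ennreal_power ennreal_mult' of_nat_0_le_iff
          zero_le_power)
    also have "\<dots> = ennreal s"
      using s m by (subst suminf_ennreal2) (auto simp: sums_iff)
    finally show ?thesis .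
  qed
  show "(\<integral>\<^sup>+\<omega>. K \<omega> \<partial>M) = ennreal m"
    using moment[of 1 m] poisson_moment_sums(1)[of m] by simp
  show "(\<integral>\<^sup>+\<omega>. (K \<omega>)\<^sup>2 \<partial>M) = ennreal (m + m\<^sup>2)"
    using moment[of 2] poisson_moment_sums(2)[of m] by simp
qed

lemma point_count_Un_disjoint:
  "A \<inter> B = {} \<Longrightarrow> point_count (A \<union> B) S = point_count A S + point_count B S"
  unfolding point_count_def Int_Un_distrib by (subst plus_emeasure) auto

lemma
  fixes N :: "'b measure"
  assumes PPP: "poisson_point_process M N \<Phi>"
    and A [measurable]: "A \<in> sets N" and fin_A: "emeasure N A < \<infinity>"
  shows poisson_count_mean: "(\<integral>\<^sup>+\<omega>. point_count A (\<Phi> \<omega>) \<partial>M) = emeasure N A"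
    and poisson_count_second_moment:
      "(\<integral>\<^sup>+\<omega>. (point_count A (\<Phi> \<omega>))\<^sup>2 \<partial>M) = emeasure N A + (emeasure N A)\<^sup>2"
proof -
  interpret prob_space M
    using PPP by (simp add: poisson_point_process_def)
  have [measurable]: "\<Phi> \<in> measurable M (config_space N)"
    using PPP by (simp add: poisson_point_process_def)
  have eq: "emeasure N A = ennreal (measure N A)"
    using fin_A by (simp add: emeasure_eq_ennreal_measure)
  have prob: "prob {\<omega> \<in> space M. point_count A (\<Phi> \<omega>) = of_nat n}
      = measure N A ^ n / fact n * exp (- measure N A)" for n
    using PPP A fin_A by (simp add: poisson_point_process_def)
  note moments = poisson_moments[of "\<lambda>\<omega>. point_count A (\<Phi> \<omega>)", OF _ _ prob]
  show "(\<integral>\<^sup>+\<omega>. point_count A (\<Phi> \<omega>) \<partial>M) = emeasure N A"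
    using moments(1) by (simp add: eq)
  show "(\<integral>\<^sup>+\<omega>. (point_count A (\<Phi> \<omega>))\<^sup>2 \<partial>M) = emeasure N A + (emeasure N A)\<^sup>2"
    using moments(2) by (simp add: eq ennreal_power)
qed

lemma poisson_count_disjoint_product:
  fixes N :: "'b measure"
  assumes PPP: "poisson_point_process M N \<Phi>"
    and A [measurable]: "A \<in> sets N" "B \<in> sets N"
    and fin: "emeasure N A < \<infinity>" "emeasure N B < \<infinity>" and disj: "A \<inter> B = {}"
  shows "(\<integral>\<^sup>+\<omega>. point_count A (\<Phi> \<omega>) * point_count B (\<Phi> \<omega>) \<partial>M) = emeasure N A * emeasure N B"
proof -
  interpret prob_space M
    using PPP by (simp add: poisson_point_process_def)
  \<comment> \<open>Independence is postulated for families indexed by naturals, so the pair is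
    coded as a family on {0, 1}.\<close>
  let ?B = "\<lambda>i::nat. if i = 0 then A else B"
  have indep: "indep_vars (\<lambda>_. borel) (\<lambda>j \<omega>. point_count (F j) (\<Phi> \<omega>)) J"
    if "finite J" "disjoint_family_on F J" "\<forall>j\<in>J. F j \<in> sets N \<and> emeasure N (F j) < \<infinity>"
    for F :: "nat \<Rightarrow> 'b set" and J
    using PPP that unfolding poisson_point_process_def by simp
  have "indep_vars (\<lambda>_. borel) (\<lambda>j \<omega>. point_count (?B j) (\<Phi> \<omega>)) {0, 1}"
    using A fin disj by (intro indep) (auto simp: disjoint_family_on_def)
  from indep_vars_nn_integral[OF _ this]
  show ?thesis
    using poisson_count_mean[OF PPP A(1) fin(1)] poisson_count_mean[OF PPP A(2) fin(2)] by simp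
qed

text \<open>Cut the two sets into the disjoint pieces \<open>A - B\<close>,
  \<open>A \<inter> B\<close> and \<open>B - A\<close>. Mixed products factor by independence; only
  the square of the count on \<open>A \<inter> B\<close> exceeds the product of the means, by its
  variance.\<close>

lemma poisson_count_product:
  fixes N :: "'b measure"
  assumes PPP: "poisson_point_process M N \<Phi>"
    and A [measurable]: "A \<in> sets N" "B \<in> sets N"
    and fin: "emeasure N A < \<infinity>" "emeasure N B < \<infinity>"
  shows "(\<integral>\<^sup>+\<omega>. point_count A (\<Phi> \<omega>) * point_count B (\<Phi> \<omega>) \<partial>M)
    = emeasure N (A \<inter> B) + emeasure N A * emeasure N B"
proof -
  have [measurable]: "\<Phi> \<in> measurable M (config_space N)"
    using PPP by (simp add: poisson_point_process_def)
  let ?P = "A - B" and ?Q = "A \<inter> B" and ?R = "B - A"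
  have split: "point_count A S = point_count ?P S + point_count ?Q S"
      "point_count B S = point_count ?Q S + point_count ?R S" for S
    by (subst point_count_Un_disjoint[symmetric]; force intro!: arg_cong2[where f = point_count])+
  have splitN: "emeasure N A = emeasure N ?P + emeasure N ?Q"
      "emeasure N B = emeasure N ?Q + emeasure N ?R"
    by (subst plus_emeasure; force intro!: arg_cong2[where f = emeasure])+
  have fins: "emeasure N ?P < \<infinity>" "emeasure N ?Q < \<infinity>" "emeasure N ?R < \<infinity>"
    using fin unfolding splitN by auto
  have "(\<integral>\<^sup>+\<omega>. point_count A (\<Phi> \<omega>) * point_count B (\<Phi> \<omega>) \<partial>M)
    = (\<integral>\<^sup>+\<omega>. point_count ?P (\<Phi> \<omega>) * point_count ?Q (\<Phi> \<omega>)
        + point_count ?P (\<Phi> \<omega>) * point_count ?R (\<Phi> \<omega>)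
        + (point_count ?Q (\<Phi> \<omega>))\<^sup>2
        + point_count ?Q (\<Phi> \<omega>) * point_count ?R (\<Phi> \<omega>) \<partial>M)"
    unfolding split by (simp add: algebra_simps power2_eq_square)
  also have "\<dots> = emeasure N ?P * emeasure N ?Q + emeasure N ?P * emeasure N ?R
        + (emeasure N ?Q + (emeasure N ?Q)\<^sup>2) + emeasure N ?Q * emeasure N ?R"
  proof -
    have "?P \<inter> ?Q = {}" "?P \<inter> ?R = {}" "?Q \<inter> ?R = {}" by auto
    then show ?thesis
      using fins by (simp add: nn_integral_add poisson_count_second_moment[OF PPP]
          poisson_count_disjoint_product[OF PPP])
  qed
  also have "\<dots> = emeasure N (A \<inter> B) + emeasure N A * emeasure N B"
    unfolding splitN by (simp add: algebra_simps power2_eq_square)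
  finally show ?thesis .
qed

lemma campbell:
  assumes PPP: "poisson_point_process M N \<Phi>" and N: "sigma_finite_measure N" "space N = UNIV"
    and f: "f \<in> borel_measurable N"
  shows "(\<integral>\<^sup>+\<omega>. point_sum f (\<Phi> \<omega>) \<partial>M) = (\<integral>\<^sup>+x. f x \<partial>N)"
  using weighted_campbell[OF N, of \<Phi> M "\<lambda>_. 1" N f] PPP f poisson_count_mean[OF PPP]
  by (simp add: poisson_point_process_def)

text \<open>Extends the product formula for counts one argument at a time: first \<open>g\<close>
  against the count of a fixed set, then \<open>f\<close> against the sum of \<open>g\<close>. The
  integral of the product \<open>f x * g x\<close> stems from points paired with themselves.\<close>

lemma campbell_product:
  assumes PPP: "poisson_point_process M N \<Phi>" and N: "sigma_finite_measure N" "space N = UNIV"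
    and f [measurable]: "f \<in> borel_measurable N" and g [measurable]: "g \<in> borel_measurable N"
  shows "(\<integral>\<^sup>+\<omega>. point_sum f (\<Phi> \<omega>) * point_sum g (\<Phi> \<omega>) \<partial>M)
    = (\<integral>\<^sup>+x. f x * g x \<partial>N) + (\<integral>\<^sup>+x. f x \<partial>N) * (\<integral>\<^sup>+x. g x \<partial>N)"
proof -
  note [measurable] = measurable_point_sum[OF _ N(2)]
  have \<Phi> [measurable]: "\<Phi> \<in> measurable M (config_space N)"
    using PPP by (simp add: poisson_point_process_def)
  \<comment> \<open>In both uses, \<open>v\<close> accounts for a point paired with itself and the
    constant \<open>c\<close> is the mean of the weight.\<close>
  have density: "(\<integral>\<^sup>+x. u x \<partial>density N (\<lambda>x. v x + c)) = (\<integral>\<^sup>+x. u x * v x \<partial>N) + (\<integral>\<^sup>+x. u x \<partial>N) * c"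
    if [measurable]: "u \<in> borel_measurable N" "v \<in> borel_measurable N"
    for u v :: "'b \<Rightarrow> ennreal" and c
    by (simp add: nn_integral_density distrib_left distrib_right mult.commute nn_integral_add
        nn_integral_cmult)
  have count: "(\<integral>\<^sup>+\<omega>. point_count B (\<Phi> \<omega>) * point_sum g (\<Phi> \<omega>) \<partial>M)
      = emeasure (density N (\<lambda>x. g x + (\<integral>\<^sup>+x. g x \<partial>N))) B"
    if B [measurable]: "B \<in> sets N" and fin_B: "emeasure N B < \<infinity>" for B
  proof -
    \<comment> \<open>Here \<open>g\<close> is the function and the count of \<open>B\<close> the
      weight, hence the swapped factors.\<close>
    have "(\<integral>\<^sup>+\<omega>. point_sum g (\<Phi> \<omega>) * point_count B (\<Phi> \<omega>) \<partial>M)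
        = (\<integral>\<^sup>+x. g x \<partial>density N (\<lambda>x. indicator B x + emeasure N B))"
    proof (rule weighted_campbell[OF N \<Phi>])
      fix A assume [measurable]: "A \<in> sets N" and fin_A: "emeasure N A < \<infinity>"
      have "emeasure (density N (\<lambda>x. indicator B x + emeasure N B)) A
          = (\<integral>\<^sup>+x. indicator A x \<partial>density N (\<lambda>x. indicator B x + emeasure N B))"
        by simp
      also have "\<dots> = emeasure N (A \<inter> B) + emeasure N A * emeasure N B"
        by (subst density) (simp_all add: indicator_inter_arith[symmetric])
      finally show "(\<integral>\<^sup>+\<omega>. point_count A (\<Phi> \<omega>) * point_count B (\<Phi> \<omega>) \<partial>M)
          = emeasure (density N (\<lambda>x. indicator B x + emeasure N B)) A"
        using poisson_count_product[OF PPP _ _ fin_A fin_B] by simp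
    qed simp_all
    \<comment> \<open>The value is symmetric in \<open>g\<close> and the indicator of
      \<open>B\<close>, so their roles can be exchanged.\<close>
    also have "\<dots> = (\<integral>\<^sup>+x. indicator B x \<partial>density N (\<lambda>x. g x + (\<integral>\<^sup>+x. g x \<partial>N)))"
      by (simp only: density f g B borel_measurable_indicator) (simp add: mult.commute)
    finally show ?thesis by (simp add: mult.commute)
  qed
  have "(\<integral>\<^sup>+\<omega>. point_sum f (\<Phi> \<omega>) * point_sum g (\<Phi> \<omega>) \<partial>M)
      = (\<integral>\<^sup>+x. f x \<partial>density N (\<lambda>x. g x + (\<integral>\<^sup>+x. g x \<partial>N)))"
    by (rule weighted_campbell[OF N \<Phi>]) (simp_all add: count)
  then show ?thesis by (simp add: density)
qed

section \<open>Independent marks\<close>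

lemma ennreal_suminf_square: "(\<Sum>p. f p)\<^sup>2 = (\<Sum>p. \<Sum>q. f p * f q)" for f :: "nat \<Rightarrow> ennreal"
  by (simp add: power2_eq_square)

lemma ennreal_suminf_diagonal:
  fixes F :: "nat \<Rightarrow> nat \<Rightarrow> ennreal"
  shows "(\<Sum>p. \<Sum>q. F p q + (if p = q then d p else 0)) = (\<Sum>p. \<Sum>q. F p q) + (\<Sum>p. d p)"
proof -
  have "(\<Sum>q. if p = q then d p else 0) = d p" for p
    by (subst suminf_finite[of "{p}"]) auto
  then show ?thesis
    by (simp add: suminf_add[symmetric])
qed

text \<open>\<open>A\<close> and \<open>B\<close> may take values in different spaces. After
  composition with \<open>f\<close> and \<open>g\<close> they share one target, so the pair is a
  family indexed by \<open>bool\<close> to which the product rule applies.\<close>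

lemma (in prob_space) indep_var_nn_integral:
  assumes "indep_var S A T B" and "f \<in> borel_measurable S" and "g \<in> borel_measurable T"
  shows "(\<integral>\<^sup>+\<omega>. f (A \<omega>) * g (B \<omega>) \<partial>M) = (\<integral>\<^sup>+\<omega>. f (A \<omega>) \<partial>M) * (\<integral>\<^sup>+\<omega>. g (B \<omega>) \<partial>M)"
proof -
  have "indep_vars (case_bool borel borel) (case_bool (f \<circ> A) (g \<circ> B)) UNIV"
    using indep_var_compose[OF assms] by (simp add: indep_var_def)
  moreover have "case_bool borel borel = (\<lambda>_. borel :: ennreal measure)"
    by (auto split: bool.split)
  ultimately have "indep_vars (\<lambda>_. borel) (case_bool (f \<circ> A) (g \<circ> B)) UNIV"
    by simp
  from indep_vars_nn_integral[OF _ this] show ?thesis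
    by (simp add: UNIV_bool mult.commute comp_def)
qed

lemma (in prob_space) indep_vars_nn_integral_pair:
  assumes indep: "indep_vars N X UNIV" and f: "\<And>i. f \<in> borel_measurable (N i)" and "i \<noteq> j"
  shows "(\<integral>\<^sup>+\<omega>. f (X i \<omega>) * f (X j \<omega>) \<partial>M) = (\<integral>\<^sup>+\<omega>. f (X i \<omega>) \<partial>M) * (\<integral>\<^sup>+\<omega>. f (X j \<omega>) \<partial>M)"
proof -
  have "indep_vars (\<lambda>_. borel) (\<lambda>i \<omega>. f (X i \<omega>)) {i, j}"
    using indep_vars_compose2[OF indep_vars_subset[OF indep, of "{i, j}"], of "\<lambda>_. f"] f by simp
  from indep_vars_nn_integral[OF _ this] show ?thesis
    using \<open>i \<noteq> j\<close> by simp
qed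

text \<open>The exponential density is the Erlang density with parameter 0, whose i-th moment at
  rate 1 is i!. The second moment is written as a product to match the diagonal case for products of
  marks.\<close>

lemma exponential_nn_moments:
  assumes "distributed M lborel X (exponential_density 1)"
  shows "(\<integral>\<^sup>+\<omega>. ennreal (X \<omega>) \<partial>M) = 1"
    and "(\<integral>\<^sup>+\<omega>. ennreal (X \<omega>) * ennreal (X \<omega>) \<partial>M) = 2"
proof -
  have "(\<integral>\<^sup>+\<omega>. ennreal (X \<omega>) \<partial>M)
      = (\<integral>\<^sup>+x. ennreal (exponential_density 1 x) * ennreal x \<partial>lborel)"
    by (rule distributed_nn_integral[OF assms, symmetric]) simp
  also have "\<dots> = (\<integral>\<^sup>+x. ennreal (exponential_density 1 x * x ^ 1) \<partial>lborel)"
    by (intro nn_integral_cong) (simp add: ennreal_mult')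
  finally show "(\<integral>\<^sup>+\<omega>. ennreal (X \<omega>) \<partial>M) = 1"
    by (subst (asm) nn_integral_erlang_ith_moment) simp_all
  have "(\<integral>\<^sup>+\<omega>. ennreal (X \<omega>) * ennreal (X \<omega>) \<partial>M)
      = (\<integral>\<^sup>+x. ennreal (exponential_density 1 x) * (ennreal x * ennreal x) \<partial>lborel)"
    by (rule distributed_nn_integral[OF assms, symmetric]) simp
  \<comment> \<open>For negative x the density vanishes, so replacing the truncated product by the
    square changes nothing.\<close>
  also have "\<dots> = (\<integral>\<^sup>+x. ennreal (exponential_density 1 x * x ^ 2) \<partial>lborel)"
    by (intro nn_integral_cong)
       (auto simp: exponential_density_def power2_eq_square ennreal_mult)
  finally show "(\<integral>\<^sup>+\<omega>. ennreal (X \<omega>) * ennreal (X \<omega>) \<partial>M) = 2"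
    by (subst (asm) nn_integral_erlang_ith_moment) simp_all
qed

text \<open>Off the diagonal the marks contribute the factor 1; on it, 2 = 1 + 1 counts the square
  of \<open>Y p\<close> once more. Only the factorisation \<open>indep\<close> is assumed, so the
  \<open>Y p\<close> may depend on each other.\<close>

lemma (in prob_space) marked_sum_second_moment:
  fixes H Y :: "nat \<Rightarrow> 'a \<Rightarrow> ennreal"
  assumes [measurable]: "\<And>p. H p \<in> borel_measurable M" "\<And>p. Y p \<in> borel_measurable M"
    and indep: "\<And>p q. (\<integral>\<^sup>+\<omega>. (H p \<omega> * H q \<omega>) * (Y p \<omega> * Y q \<omega>) \<partial>M)
      = (\<integral>\<^sup>+\<omega>. H p \<omega> * H q \<omega> \<partial>M) * (\<integral>\<^sup>+\<omega>. Y p \<omega> * Y q \<omega> \<partial>M)"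
    and H: "\<And>p q. (\<integral>\<^sup>+\<omega>. H p \<omega> * H q \<omega> \<partial>M) = (if p = q then 2 else 1)"
  shows "(\<integral>\<^sup>+\<omega>. (\<Sum>p. H p \<omega> * Y p \<omega>)\<^sup>2 \<partial>M)
    = (\<integral>\<^sup>+\<omega>. (\<Sum>p. Y p \<omega>)\<^sup>2 \<partial>M) + (\<integral>\<^sup>+\<omega>. (\<Sum>p. (Y p \<omega>)\<^sup>2) \<partial>M)"
proof -
  have "(\<integral>\<^sup>+\<omega>. (\<Sum>p. H p \<omega> * Y p \<omega>)\<^sup>2 \<partial>M)
      = (\<integral>\<^sup>+\<omega>. (\<Sum>p. \<Sum>q. (H p \<omega> * H q \<omega>) * (Y p \<omega> * Y q \<omega>)) \<partial>M)"
    unfolding ennreal_suminf_square by (simp only: mult_ac)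
  also have "\<dots> = (\<Sum>p. \<Sum>q. \<integral>\<^sup>+\<omega>. (H p \<omega> * H q \<omega>) * (Y p \<omega> * Y q \<omega>) \<partial>M)"
    by (simp add: nn_integral_suminf del: ennreal_suminf_cmult ennreal_suminf_multc)
  also have "\<dots> = (\<Sum>p. \<Sum>q. (\<integral>\<^sup>+\<omega>. Y p \<omega> * Y q \<omega> \<partial>M)
      + (if p = q then (\<integral>\<^sup>+\<omega>. Y p \<omega> * Y p \<omega> \<partial>M) else 0))"
    unfolding indep H by (intro suminf_cong) (simp add: mult_2)
  also have "\<dots> = (\<Sum>p. \<Sum>q. \<integral>\<^sup>+\<omega>. Y p \<omega> * Y q \<omega> \<partial>M) + (\<Sum>p. \<integral>\<^sup>+\<omega>. Y p \<omega> * Y p \<omega> \<partial>M)"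
    by (rule ennreal_suminf_diagonal)
  also have "\<dots> = (\<integral>\<^sup>+\<omega>. (\<Sum>p. Y p \<omega>)\<^sup>2 \<partial>M) + (\<integral>\<^sup>+\<omega>. (\<Sum>p. (Y p \<omega>)\<^sup>2) \<partial>M)"
    unfolding ennreal_suminf_square
    by (simp add: nn_integral_suminf power2_eq_square del: ennreal_suminf_cmult ennreal_suminf_multc)
  finally show ?thesis .
qed

text \<open>The product moments are those of pairwise uncorrelated variables with mean
  \<open>m\<close> and variance \<open>v\<close>; stated as raw moments, they avoid subtraction in
  [0, infinity].\<close>

lemma weighted_sum_second_moment:
  fixes N :: "nat \<Rightarrow> 'a \<Rightarrow> ennreal"
  assumes [measurable]: "\<And>k. N k \<in> borel_measurable M"
    and N: "\<And>k l. (\<integral>\<^sup>+\<omega>. N k \<omega> * N l \<omega> \<partial>M) = m * m + (if k = l then v else 0)"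
  shows "(\<integral>\<^sup>+\<omega>. (\<Sum>k. c k * N k \<omega>)\<^sup>2 \<partial>M) = ((\<Sum>k. c k) * m)\<^sup>2 + (\<Sum>k. (c k)\<^sup>2) * v"
proof -
  have "(\<integral>\<^sup>+\<omega>. (\<Sum>k. c k * N k \<omega>)\<^sup>2 \<partial>M)
      = (\<integral>\<^sup>+\<omega>. (\<Sum>k. \<Sum>l. (c k * c l) * (N k \<omega> * N l \<omega>)) \<partial>M)"
    unfolding ennreal_suminf_square by (simp only: mult_ac)
  also have "\<dots> = (\<Sum>k. \<Sum>l. (c k * c l) * (\<integral>\<^sup>+\<omega>. N k \<omega> * N l \<omega> \<partial>M))"
    by (simp add: nn_integral_suminf nn_integral_cmult
        del: ennreal_suminf_cmult ennreal_suminf_multc)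
  also have "\<dots> = (\<Sum>k. \<Sum>l. (c k * m) * (c l * m) + (if k = l then (c k)\<^sup>2 * v else 0))"
    unfolding N by (intro suminf_cong) (auto simp: algebra_simps power2_eq_square)
  also have "\<dots> = (\<Sum>k. c k * m)\<^sup>2 + (\<Sum>k. (c k)\<^sup>2 * v)"
    unfolding ennreal_suminf_diagonal ennreal_suminf_square ..
  finally show ?thesis by simp
qed

section \<open>The street intensity and the path losses\<close>

lemma sets_street_intensity [measurable_cong, simp]: "sets (street_intensity lam) = sets borel"
  by (simp add: street_intensity_def)

lemma space_street_intensity [simp]: "space (street_intensity lam) = UNIV"
  by (simp add: street_intensity_def)

lemma sigma_finite_street_intensity: "sigma_finite_measure (street_intensity lam)"
  unfolding street_intensity_def
  by (subst sigma_finite_measure.sigma_finite_iff_density_finite[OF sigma_finite_lborel])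
     (auto simp: indicator_def ennreal_mult_eq_top_iff intro!: AE_I2)

text \<open>The antiderivative -x^(-n)/n gives 1/n on each of the two half-lines. The case n = 1
  yields the mean of a street sum, n = 3 its variance.\<close>

lemma nn_integral_street_intensity_power:
  assumes "lam > 0" and "n \<ge> 1"
  shows "(\<integral>\<^sup>+x. ennreal (\<bar>x\<bar> powr (- real (Suc n))) \<partial>street_intensity lam) = ennreal (2 * lam / n)"
proof -
  let ?f = "\<lambda>x::real. ennreal (\<bar>x\<bar> powr (- real (Suc n)))"
  have pos: "(\<integral>\<^sup>+x. ?f x * indicator {1..} x \<partial>lborel) = ennreal (1 / n)"
  proof -
    have "(\<integral>\<^sup>+x. ?f x * indicator {1..} x \<partial>lborel) = ennreal (0 - (- (1 powr (- real n)) / n))"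
    proof (rule nn_integral_FTC_atLeast)
      fix x :: real assume x: "1 \<le> x"
      then have "((\<lambda>x. - (x powr (- real n)) / n) has_real_derivative
          - (- real n * x powr (- real n - 1)) / n) (at x)"
        using assms(2) by (auto intro!: derivative_eq_intros)
      moreover have "- real n - 1 = - real (Suc n)" by simp
      ultimately show "((\<lambda>x. - (x powr (- real n)) / n) has_real_derivative \<bar>x\<bar> powr (- real (Suc n))) (at x)"
        using assms(2) x by simp
    next
      have "((\<lambda>x::real. x powr (- real n)) \<longlongrightarrow> 0) at_top"
        using assms(2) by (intro tendsto_neg_powr filterlim_ident) auto
      from tendsto_divide[OF tendsto_minus[OF this] tendsto_const[of "real n"]]
      show "((\<lambda>x. - (x powr (- real n)) / n) \<longlongrightarrow> 0) at_top"
        using assms(2) by simp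
    qed auto
    then show ?thesis by simp
  qed
  have neg: "(\<integral>\<^sup>+x. ?f x * indicator {..-1} x \<partial>lborel) = ennreal (1 / n)"
  proof -
    \<comment> \<open>Reflection preserves Lebesgue measure and exchanges the half-lines.\<close>
    have "(\<integral>\<^sup>+x. ?f x * indicator {..-1} x \<partial>lborel)
        = (\<integral>\<^sup>+x. ?f x * indicator {..-1} x \<partial>distr lborel borel uminus)"
      by (simp add: lborel_distr_uminus)
    also have "\<dots> = (\<integral>\<^sup>+x. ?f x * indicator {1..} x \<partial>lborel)"
      by (subst nn_integral_distr) (auto intro!: nn_integral_cong simp: indicator_def)
    finally show ?thesis using pos by simp
  qed
  have "(\<integral>\<^sup>+x. ?f x \<partial>street_intensity lam)
      = (\<integral>\<^sup>+x. ennreal lam * (?f x * indicator {1..} x + ?f x * indicator {..-1} x) \<partial>lborel)"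
    unfolding street_intensity_def
    by (subst nn_integral_density) (auto intro!: nn_integral_cong simp: indicator_def abs_if)
  also have "\<dots> = ennreal lam * (ennreal (1 / n) + ennreal (1 / n))"
    by (simp add: nn_integral_cmult nn_integral_add pos neg del: of_nat_Suc)
  also have "\<dots> = ennreal (2 * lam / n)"
    using assms by (simp add: ennreal_plus[symmetric] ennreal_mult[symmetric] del: ennreal_plus)
  finally show ?thesis .
qed

lemma riemann_zeta_summable: "s > 1 \<Longrightarrow> summable (\<lambda>n. 1 / real (Suc n) powr s)"
  using summable_real_powr_iff[of "- s"]
  by (subst summable_Suc_iff) (simp add: powr_minus divide_inverse)

text \<open>Street 0, at distance 1, supplies the summand 1; the streets \<open>Suc n\<close> supply
  the zeta series scaled by \<open>D powr s\<close>.\<close>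

lemma street_dist_sums:
  assumes "D > 0" and "s > 1"
  shows "(\<lambda>k. 1 / street_dist D k powr s) sums (1 + riemann_zeta s / D powr s)"
proof -
  have "(\<lambda>n. 1 / real (Suc n) powr s) sums riemann_zeta s"
    unfolding riemann_zeta_def using riemann_zeta_summable[OF assms(2)] by (rule summable_sums)
  from sums_divide[OF this, of "D powr s"]
  have "(\<lambda>n. 1 / street_dist D (Suc n) powr s) sums (riemann_zeta s / D powr s)"
    using assms(1) by (simp add: street_dist_def powr_mult)
  then show ?thesis
    by (subst (asm) sums_Suc_iff) (simp add: street_dist_def add.commute)
qed

section \<open>The two moments of the interference\<close>

theorem mainTheorem5:
  fixes M :: "'a measure"
    and \<Phi> :: "nat \<Rightarrow> 'a \<Rightarrow> real set"
    and X h :: "nat \<Rightarrow> nat \<Rightarrow> 'a \<Rightarrow> real"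
    and lam Pt C D \<alpha> z :: real
    and \<beta> :: "nat \<Rightarrow> real"
    and I :: "'a \<Rightarrow> ennreal"
  assumes "lam > 0" and "Pt > 0" and "C > 0" and "D > 0" and "\<alpha> > 1"
    and z: "z = Pt * C"
    and \<beta>: "\<And>k. \<beta> k = street_dist D k powr \<alpha>"
    and "prob_space M"
    and poisson: "\<And>k. poisson_point_process M (street_intensity lam) (\<Phi> k)"
    and indep: "prob_space.indep_vars M (\<lambda>_. config_space borel) \<Phi> UNIV"
    and points: "\<And>k. enumerates_points M (\<Phi> k) (X k)"
    and marks: "iid_exp_marks M X h"
    and I: "I = interference Pt C D \<alpha> X h"
  shows "(\<integral>\<^sup>+\<omega>. I \<omega> \<partial>M) = ennreal (2 * lam * (\<Sum>k. z / \<beta> k))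
    \<and> 2 * lam * (\<Sum>k. z / \<beta> k) = 2 * lam * z * (1 + riemann_zeta \<alpha> / D powr \<alpha>)
    \<and> (\<integral>\<^sup>+\<omega>. (I \<omega>)\<^sup>2 \<partial>M) =
        ennreal (4 * lam / 3 * (\<Sum>k. z\<^sup>2 / (\<beta> k)\<^sup>2)) + (\<integral>\<^sup>+\<omega>. I \<omega> \<partial>M)\<^sup>2
    \<and> ennreal (4 * lam / 3 * (\<Sum>k. z\<^sup>2 / (\<beta> k)\<^sup>2)) + (\<integral>\<^sup>+\<omega>. I \<omega> \<partial>M)\<^sup>2 =
        ennreal (4 * lam * z\<^sup>2 / 3 * (1 + riemann_zeta (2 * \<alpha>) / D powr (2 * \<alpha>)))
          + (\<integral>\<^sup>+\<omega>. I \<omega> \<partial>M)\<^sup>2"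
proof -
  interpret prob_space M by fact
  define c where "c k = ennreal (z / \<beta> k)" for k
  define g where "g x = ennreal (\<bar>x\<bar> powr (- 2))" for x :: real
  define N where "N k \<omega> = point_sum g (\<Phi> k \<omega>)" for k \<omega>
  \<comment> \<open>\<open>prod_decode\<close> flattens the pairs of street and point to one index,
    so the square of the interference becomes a plain double series.\<close>
  define H where "H p \<omega> = ennreal (case_prod h (prod_decode p) \<omega>)" for p \<omega>
  define Y where "Y p \<omega> = (case prod_decode p of (k, i) \<Rightarrow> c k * g (X k i \<omega>))" for p \<omega>

  have z_pos: "z > 0" using assms by simp
  have \<beta>_pos: "\<beta> k > 0" for k
    using \<open>D > 0\<close> by (simp add: \<beta> street_dist_def)
  have g [measurable]: "g \<in> borel_measurable borel" by (simp add: g_def[abs_def])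
  have [measurable]: "X k i \<in> borel_measurable M" for k i
    using points[of k] by (simp add: enumerates_points_def)
  have h_exp: "distributed M lborel (h k i) (exponential_density 1)" for k i
    using marks by (simp add: iid_exp_marks_def)
  have [measurable]: "h k i \<in> borel_measurable M" for k i
    using distributed_measurable[OF h_exp[of k i]] by simp
  have H_meas [measurable]: "H p \<in> borel_measurable M" for p
    unfolding H_def by (cases "prod_decode p") simp
  have Y_meas [measurable]: "Y p \<in> borel_measurable M" for p
    unfolding Y_def by (cases "prod_decode p") simp
  have \<Phi> [measurable]: "\<Phi> k \<in> measurable M (config_space borel)" for k
    using poisson[of k] sets_config_space_cong[OF sets_street_intensity, of lam]
    by (simp add: poisson_point_process_def)
  have [measurable]: "N k \<in> borel_measurable M" for k
    unfolding N_def by (rule measurable_compose[OF \<Phi>]) (simp add: measurable_point_sum)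

  have I_eq: "I \<omega> = (\<Sum>p. H p \<omega> * Y p \<omega>)" for \<omega>
  proof -
    have "ennreal (Pt * h k i \<omega> * path_loss C \<alpha> (X k i \<omega>) (street_dist D k))
        = ennreal (h k i \<omega>) * (c k * g (X k i \<omega>))" for k i
    proof -
      have "Pt * h k i \<omega> * path_loss C \<alpha> (X k i \<omega>) (street_dist D k)
          = h k i \<omega> * (z / \<beta> k * \<bar>X k i \<omega>\<bar> powr (- 2))"
        by (simp add: path_loss_def z \<beta> powr_minus divide_inverse)
      moreover have "0 \<le> z / \<beta> k"
        using z_pos \<beta>_pos[of k] by simp
      \<comment> \<open>The cofactor of the mark is nonnegative, so a negative mark is truncated to
        0 on both sides and the identity holds at every outcome.\<close>
      ultimately show ?thesis
        by (simp only: c_def g_def ennreal_mult'' mult_nonneg_nonneg powr_ge_zero)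
    qed
    then have "I \<omega> = (\<Sum>k. \<Sum>i. ennreal (h k i \<omega>) * (c k * g (X k i \<omega>)))"
      by (simp add: I interference_def)
    also have "\<dots> = (\<Sum>p. case prod_decode p of (k, i) \<Rightarrow> ennreal (h k i \<omega>) * (c k * g (X k i \<omega>)))"
      by (rule suminf_ennreal_2dimen[symmetric]) simp
    also have "\<dots> = (\<Sum>p. H p \<omega> * Y p \<omega>)"
      by (simp add: H_def Y_def split_beta)
    finally show ?thesis .
  qed

  have "AE \<omega> in M. \<forall>k. bij_betw (\<lambda>i. X k i \<omega>) UNIV (\<Phi> k \<omega>)"
    using points by (simp add: enumerates_points_def AE_all_countable)
  \<comment> \<open>The bijections do not involve \<open>f\<close> and there are countably many
    streets, so one null set serves all \<open>f\<close> and \<open>k\<close>.\<close>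
  then have point_sums: "AE \<omega> in M. \<forall>f k. point_sum f (\<Phi> k \<omega>) = (\<Sum>i. f (X k i \<omega>))"
    by eventually_elim (intro allI point_sum_bij, simp)
  have sum_Y: "AE \<omega> in M. (\<Sum>p. Y p \<omega>) = (\<Sum>k. c k * N k \<omega>)"
    using point_sums
  proof eventually_elim
    case (elim \<omega>)
    have "(\<Sum>p. Y p \<omega>) = (\<Sum>k. \<Sum>i. c k * g (X k i \<omega>))"
      unfolding Y_def by (rule suminf_ennreal_2dimen) simp
    also have "\<dots> = (\<Sum>k. c k * N k \<omega>)"
      using elim by (simp add: N_def)
    finally show ?case .
  qed
  have sum_Y2: "AE \<omega> in M. (\<Sum>p. (Y p \<omega>)\<^sup>2) = (\<Sum>k. (c k)\<^sup>2 * point_sum (\<lambda>x. (g x)\<^sup>2) (\<Phi> k \<omega>))"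
    using point_sums
  proof eventually_elim
    case (elim \<omega>)
    have "(\<Sum>p. (Y p \<omega>)\<^sup>2) = (\<Sum>p. case prod_decode p of (k, i) \<Rightarrow> (c k)\<^sup>2 * (g (X k i \<omega>))\<^sup>2)"
      by (simp add: Y_def split_beta power_mult_distrib)
    also have "\<dots> = (\<Sum>k. \<Sum>i. (c k)\<^sup>2 * (g (X k i \<omega>))\<^sup>2)"
      by (rule suminf_ennreal_2dimen) simp
    also have "\<dots> = (\<Sum>k. (c k)\<^sup>2 * (\<Sum>i. (g (X k i \<omega>))\<^sup>2))"
      by simp
    also have "\<dots> = (\<Sum>k. (c k)\<^sup>2 * point_sum (\<lambda>x. (g x)\<^sup>2) (\<Phi> k \<omega>))"
      using elim by simp
    finally show ?case .
  qed

  \<comment> \<open>Moments of the street sums\<close>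
  define m where "m = ennreal (2 * lam)"
  define v where "v = ennreal (2 * lam / 3)"
  note PPP = poisson sigma_finite_street_intensity space_street_intensity
  have g_int: "(\<integral>\<^sup>+x. g x \<partial>street_intensity lam) = m"
    using nn_integral_street_intensity_power[OF \<open>lam > 0\<close>, of 1] by (simp add: g_def m_def)
  have g2: "(g x)\<^sup>2 = ennreal (\<bar>x\<bar> powr (- 4))" for x
    by (simp add: g_def power2_eq_square flip: ennreal_mult powr_add)
  have g2_int: "(\<integral>\<^sup>+x. (g x)\<^sup>2 \<partial>street_intensity lam) = v"
    using nn_integral_street_intensity_power[OF \<open>lam > 0\<close>, of 3] by (simp add: g2 v_def)
  have mean_N: "(\<integral>\<^sup>+\<omega>. N k \<omega> \<partial>M) = m" for k
    unfolding N_def by (subst campbell[OF PPP]) (simp_all add: g_int)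
  \<comment> \<open>Within one street this is the second-order Campbell formula; for two streets the
    processes are independent.\<close>
  have prod_N: "(\<integral>\<^sup>+\<omega>. N k \<omega> * N l \<omega> \<partial>M) = m * m + (if k = l then v else 0)" for k l
  proof (cases "k = l")
    case True
    have "(\<integral>\<^sup>+\<omega>. N k \<omega> * N k \<omega> \<partial>M) = v + m * m"
      unfolding N_def
      by (subst campbell_product[OF PPP]) (simp_all add: g_int g2_int power2_eq_square[symmetric])
    with True show ?thesis by (simp add: add.commute)
  next
    case False
    have "(\<integral>\<^sup>+\<omega>. N k \<omega> * N l \<omega> \<partial>M) = (\<integral>\<^sup>+\<omega>. N k \<omega> \<partial>M) * (\<integral>\<^sup>+\<omega>. N l \<omega> \<partial>M)"
      unfolding N_def
      by (rule indep_vars_nn_integral_pair[OF indep _ False]) (simp add: measurable_point_sum)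
    with False show ?thesis by (simp add: mean_N)
  qed

  \<comment> \<open>Moments of the marks and their independence of the locations\<close>
  have mean_H: "(\<integral>\<^sup>+\<omega>. H p \<omega> \<partial>M) = 1" for p
    unfolding H_def by (cases "prod_decode p") (simp add: exponential_nn_moments[OF h_exp])
  have prod_H: "(\<integral>\<^sup>+\<omega>. H p \<omega> * H q \<omega> \<partial>M) = (if p = q then 2 else 1)" for p q
  proof (cases "p = q")
    case True
    then show ?thesis
      unfolding H_def by (cases "prod_decode p") (simp add: exponential_nn_moments[OF h_exp])
  next
    case False
    then have "prod_decode p \<noteq> prod_decode q" by (simp add: prod_decode_eq)
    moreover have "indep_vars (\<lambda>_. borel) (case_prod h) UNIV"
      using marks by (simp add: iid_exp_marks_def)
    ultimately have "(\<integral>\<^sup>+\<omega>. H p \<omega> * H q \<omega> \<partial>M) = (\<integral>\<^sup>+\<omega>. H p \<omega> \<partial>M) * (\<integral>\<^sup>+\<omega>. H q \<omega> \<partial>M)"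
      unfolding H_def by (intro indep_vars_nn_integral_pair) auto
    with False show ?thesis by (simp add: mean_H)
  qed

  let ?P = "Pi\<^sub>M UNIV (\<lambda>_. borel) :: (nat \<times> nat \<Rightarrow> real) measure"
  have hX: "indep_var ?P (\<lambda>\<omega> (k, i). h k i \<omega>) ?P (\<lambda>\<omega> (k, i). X k i \<omega>)"
    using marks by (simp add: iid_exp_marks_def)
  have HY: "(\<integral>\<^sup>+\<omega>. H p \<omega> * Y p \<omega> \<partial>M) = (\<integral>\<^sup>+\<omega>. H p \<omega> \<partial>M) * (\<integral>\<^sup>+\<omega>. Y p \<omega> \<partial>M)" for p
    using indep_var_nn_integral[OF hX, of "\<lambda>u. ennreal (u (prod_decode p))"
        "\<lambda>u. c (fst (prod_decode p)) * g (u (prod_decode p))"]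
    by (simp add: H_def Y_def split_beta)
  \<comment> \<open>The whole families of marks and points are independent, so functions reading two
    coordinates of each still factor, whatever the dependence among the points.\<close>
  have HHYY: "(\<integral>\<^sup>+\<omega>. (H p \<omega> * H q \<omega>) * (Y p \<omega> * Y q \<omega>) \<partial>M)
      = (\<integral>\<^sup>+\<omega>. H p \<omega> * H q \<omega> \<partial>M) * (\<integral>\<^sup>+\<omega>. Y p \<omega> * Y q \<omega> \<partial>M)" for p q
    using indep_var_nn_integral[OF hX,
        of "\<lambda>u. ennreal (u (prod_decode p)) * ennreal (u (prod_decode q))"
        "\<lambda>u. (c (fst (prod_decode p)) * g (u (prod_decode p))) *
           (c (fst (prod_decode q)) * g (u (prod_decode q)))"]
    by (simp add: H_def Y_def split_beta)

  \<comment> \<open>Assembling both moments\<close>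
  have "(\<integral>\<^sup>+\<omega>. I \<omega> \<partial>M) = (\<Sum>p. \<integral>\<^sup>+\<omega>. Y p \<omega> \<partial>M)"
    unfolding I_eq by (simp add: nn_integral_suminf HY mean_H)
  \<comment> \<open>The location terms are summed again before being evaluated: single terms depend
    on the enumeration, their total almost surely does not.\<close>
  also have "\<dots> = (\<integral>\<^sup>+\<omega>. (\<Sum>p. Y p \<omega>) \<partial>M)"
    by (simp add: nn_integral_suminf)
  also have "\<dots> = (\<integral>\<^sup>+\<omega>. (\<Sum>k. c k * N k \<omega>) \<partial>M)"
    by (rule nn_integral_cong_AE[OF sum_Y])
  also have "\<dots> = (\<Sum>k. c k) * m"
    by (simp add: nn_integral_suminf nn_integral_cmult mean_N)
  finally have first: "(\<integral>\<^sup>+\<omega>. I \<omega> \<partial>M) = (\<Sum>k. c k) * m" .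

  have "(\<integral>\<^sup>+\<omega>. (I \<omega>)\<^sup>2 \<partial>M) = (\<integral>\<^sup>+\<omega>. (\<Sum>p. Y p \<omega>)\<^sup>2 \<partial>M) + (\<integral>\<^sup>+\<omega>. (\<Sum>p. (Y p \<omega>)\<^sup>2) \<partial>M)"
    unfolding I_eq by (rule marked_sum_second_moment[OF H_meas Y_meas HHYY prod_H])
  also have "(\<integral>\<^sup>+\<omega>. (\<Sum>p. Y p \<omega>)\<^sup>2 \<partial>M) = (\<integral>\<^sup>+\<omega>. (\<Sum>k. c k * N k \<omega>)\<^sup>2 \<partial>M)"
    by (rule nn_integral_cong_AE) (use sum_Y in eventually_elim, simp)
  also have "\<dots> = ((\<Sum>k. c k) * m)\<^sup>2 + (\<Sum>k. (c k)\<^sup>2) * v"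
    by (rule weighted_sum_second_moment[OF _ prod_N]) simp
  also have "(\<integral>\<^sup>+\<omega>. (\<Sum>p. (Y p \<omega>)\<^sup>2) \<partial>M)
      = (\<integral>\<^sup>+\<omega>. (\<Sum>k. (c k)\<^sup>2 * point_sum (\<lambda>x. (g x)\<^sup>2) (\<Phi> k \<omega>)) \<partial>M)"
    by (rule nn_integral_cong_AE[OF sum_Y2])
  also have "\<dots> = (\<Sum>k. (c k)\<^sup>2 * (\<integral>\<^sup>+\<omega>. point_sum (\<lambda>x. (g x)\<^sup>2) (\<Phi> k \<omega>) \<partial>M))"
  proof -
    have [measurable]: "(\<lambda>\<omega>. point_sum (\<lambda>x. (g x)\<^sup>2) (\<Phi> k \<omega>)) \<in> borel_measurable M" for k
      by (rule measurable_compose[OF \<Phi>]) (simp add: measurable_point_sum)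
    show ?thesis by (simp add: nn_integral_suminf nn_integral_cmult)
  qed
  also have "\<dots> = (\<Sum>k. (c k)\<^sup>2) * v"
    by (subst campbell[OF PPP]) (simp_all add: g2_int)
  \<comment> \<open>One \<open>v\<close> is the variance of the street sums, the other comes from
    the excess 1 in the second moment of the marks.\<close>
  finally have second: "(\<integral>\<^sup>+\<omega>. (I \<omega>)\<^sup>2 \<partial>M) = (\<Sum>k. (c k)\<^sup>2) * (2 * v) + ((\<Sum>k. c k) * m)\<^sup>2"
    by (simp add: algebra_simps mult_2)

  \<comment> \<open>Evaluation of the series over the streets\<close>
  have sums1: "(\<lambda>k. z / \<beta> k) sums (z * (1 + riemann_zeta \<alpha> / D powr \<alpha>))"
    using sums_mult[OF street_dist_sums[OF \<open>D > 0\<close> \<open>\<alpha> > 1\<close>], of z] by (simp add: \<beta>)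
  \<comment> \<open>Squaring doubles the exponent, which is where the zeta value at 2 \<alpha> comes
    from.\<close>
  have \<beta>_sq: "(\<beta> k)\<^sup>2 = street_dist D k powr (2 * \<alpha>)" for k
    by (simp add: \<beta> power2_eq_square flip: powr_add)
  have sums2: "(\<lambda>k. z\<^sup>2 / (\<beta> k)\<^sup>2) sums (z\<^sup>2 * (1 + riemann_zeta (2 * \<alpha>) / D powr (2 * \<alpha>)))"
    using sums_mult[OF street_dist_sums[OF \<open>D > 0\<close>, of "2 * \<alpha>"], of "z\<^sup>2"] \<open>\<alpha> > 1\<close>
    by (simp add: \<beta>_sq)
  \<comment> \<open>The terms are nonnegative and summable, so \<open>ennreal\<close> commutes with
    the series.\<close>
  have "(\<Sum>k. c k) = ennreal (\<Sum>k. z / \<beta> k)"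
    unfolding c_def using z_pos \<beta>_pos sums_summable[OF sums1]
    by (intro suminf_ennreal2) (simp_all add: less_imp_le)
  moreover have "0 \<le> (\<Sum>k. z / \<beta> k)"
    using z_pos \<beta>_pos sums_summable[OF sums1] by (intro suminf_nonneg) (simp_all add: less_imp_le)
  ultimately have mean: "(\<Sum>k. c k) * m = ennreal (2 * lam * (\<Sum>k. z / \<beta> k))"
    using \<open>lam > 0\<close> by (simp add: m_def ennreal_mult[symmetric] mult.commute)
  have "(\<Sum>k. (c k)\<^sup>2) = (\<Sum>k. ennreal (z\<^sup>2 / (\<beta> k)\<^sup>2))"
    unfolding c_def using z_pos \<beta>_pos
    by (simp add: ennreal_power less_imp_le power_divide)
  also have "\<dots> = ennreal (\<Sum>k. z\<^sup>2 / (\<beta> k)\<^sup>2)"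
    using sums_summable[OF sums2] by (intro suminf_ennreal2) simp_all
  finally have sum_c2: "(\<Sum>k. (c k)\<^sup>2) = ennreal (\<Sum>k. z\<^sup>2 / (\<beta> k)\<^sup>2)" .
  have two_v: "2 * v = ennreal (4 * lam / 3)"
    unfolding mult_2[of v] using \<open>lam > 0\<close> by (simp add: v_def flip: ennreal_plus)
  have var: "(\<Sum>k. (c k)\<^sup>2) * (2 * v) = ennreal (4 * lam / 3 * (\<Sum>k. z\<^sup>2 / (\<beta> k)\<^sup>2))"
    unfolding sum_c2 two_v using \<open>lam > 0\<close> suminf_nonneg[OF sums_summable[OF sums2]]
    by (simp add: ennreal_mult[symmetric] mult.commute)
  show ?thesis
    unfolding second first mean var
    unfolding sums_unique[OF sums1, symmetric] sums_unique[OF sums2, symmetric]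
    by (simp add: field_simps)
qed

end
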